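(* For every positive integer $n$ there exists a finite solvable group $G$ whose nilpotency length is at least $n$ and whose rank is at least $n$, such that every maximal subgroup $M$ of $G$ with $\pi(M)=\pi(G)$ is supersolvable.
   Context: For a finite group $X$, $\pi(X)$ denotes the set of all prime divisors of the order $|X|$. A finite group is supersolvable if all of its chief factors are cyclic of prime order. The nilpotency length (Fitting height) of a finite solvable group $G$ is the smallest integer $h\ge 0$ such that $G$ has a normal series $1=F_0\le F_1\le\cdots\le F_h=G$ with each $F_i$ normal in $G$ and each $F_{i}/F_{i-1}$ nilpotent. The rank of a finite solvable group $G$ is the largest integer $k$ such that $G$ has a chief factor of order $p^k$ for some prime $p$. *)

theory Defs
  imports "HOL-Algebra.Solvable_Groups" "HOL-Algebra.Elementary_Groups"
    "HOL-Computational_Algebra.Primes"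
begin

abbreviation subquotient ::
    "('a, 'b) monoid_scheme \<Rightarrow> 'a set \<Rightarrow> 'a set \<Rightarrow> 'a set monoid" where
  "subquotient G H K \<equiv> (G\<lparr>carrier := H\<rparr>) Mod K"

definition prime_divisors_order :: "('a, 'b) monoid_scheme \<Rightarrow> nat set" where
  "prime_divisors_order G = {p. prime p \<and> p dvd order G}"

definition maximal_subgroup :: "'a set \<Rightarrow> ('a, 'b) monoid_scheme \<Rightarrow> bool" where
  "maximal_subgroup M G \<longleftrightarrow>
     subgroup M G \<and> M \<noteq> carrier G \<and>
     (\<forall>H. subgroup H G \<longrightarrow> M \<subseteq> H \<longrightarrow> H = M \<or> H = carrier G)"

text \<open>\<^prop>\<open>chief_factor G H K\<close> says that \<open>H / K\<close> is a chief factor of \<open>G\<close>; equivalently,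
  \<open>H / K\<close> is a minimal normal subgroup of \<open>G / K\<close>.\<close>

definition chief_factor :: "('a, 'b) monoid_scheme \<Rightarrow> 'a set \<Rightarrow> 'a set \<Rightarrow> bool" where
  "chief_factor G H K \<longleftrightarrow>
     H \<lhd> G \<and> K \<lhd> G \<and> K \<subset> H \<and>
     (\<forall>N. N \<lhd> G \<longrightarrow> K \<subseteq> N \<longrightarrow> N \<subseteq> H \<longrightarrow> N = K \<or> N = H)"

definition supersolvable_group :: "('a, 'b) monoid_scheme \<Rightarrow> bool" where
  "supersolvable_group G \<longleftrightarrow>
     group G \<and> finite (carrier G) \<and>
     (\<forall>H K. chief_factor G H K \<longrightarrow>
        cyclic_group (subquotient G H K) \<and> prime (order (subquotient G H K)))"

primrec lower_central_series :: "('a, 'b) monoid_scheme \<Rightarrow> nat \<Rightarrow> 'a set" where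
  "lower_central_series G 0 = carrier G"
| "lower_central_series G (Suc i) =
     generate G {x \<otimes>\<^bsub>G\<^esub> y \<otimes>\<^bsub>G\<^esub> inv\<^bsub>G\<^esub> x \<otimes>\<^bsub>G\<^esub> inv\<^bsub>G\<^esub> y | x y.
                   x \<in> lower_central_series G i \<and> y \<in> carrier G}"

definition nilpotent_group :: "('a, 'b) monoid_scheme \<Rightarrow> bool" where
  "nilpotent_group G \<longleftrightarrow> group G \<and> (\<exists>c. lower_central_series G c = {\<one>\<^bsub>G\<^esub>})"

definition nilpotent_series :: "('a, 'b) monoid_scheme \<Rightarrow> nat \<Rightarrow> (nat \<Rightarrow> 'a set) \<Rightarrow> bool" where
  "nilpotent_series G h F \<longleftrightarrow>
     F 0 = {\<one>\<^bsub>G\<^esub>} \<and> F h = carrier G \<and>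
     (\<forall>i\<le>h. F i \<lhd> G) \<and>
     (\<forall>i<h. F i \<subseteq> F (Suc i) \<and> nilpotent_group (subquotient G (F (Suc i)) (F i)))"

text \<open>Meaningful only for solvable \<open>G\<close>: otherwise no such series exists.\<close>

definition nilpotency_length :: "('a, 'b) monoid_scheme \<Rightarrow> nat" where
  "nilpotency_length G = (LEAST h. \<exists>F. nilpotent_series G h F)"

text \<open>Meaningful only for nontrivial finite solvable \<open>G\<close>: the trivial group has no chief factor, and
  its rank is left unspecified.\<close>

definition group_rank :: "('a, 'b) monoid_scheme \<Rightarrow> nat" where
  "group_rank G =
     (GREATEST k. \<exists>H K p. prime (p::nat) \<and> chief_factor G H K \<and>
                           order (subquotient G H K) = p ^ k)"

end

theory Submission
  imports Defs "HOL-Algebra.Product_Groups" "HOL-Algebra.Weak_Morphisms"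
begin

text \<open>
  The group is built so that each prime divisor of its order belongs to exactly one chief factor. Every
  maximal subgroup then has index a full Sylow order, so it misses a prime and the condition on maximal
  subgroups is vacuous. Start with a cyclic group of large odd prime order. Given \<open>G\<close> with a unique
  minimal normal subgroup \<open>N\<close> and a prime \<open>p\<close> not dividing its order, choose an irreducible module
  \<open>V\<close> over the field with \<open>p\<close> elements on which \<open>N\<close> acts nontrivially, so that \<open>G\<close> acts faithfully, and pass
  to the semidirect product of \<open>V\<close> and \<open>G\<close>. There \<open>V\<close> is the unique minimal normal subgroup and
  its own centralizer, so it contains every nilpotent normal subgroup and the nilpotency length grows by
  one. All primes used are odd until the last step, where \<open>p = 2\<close>: as \<open>G\<close> embeds into the maps from
  \<open>V\<close> to itself, a large \<open>G\<close> forces \<open>V\<close> to have large dimension.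
\<close>

subsection \<open>Lower central series and nilpotent series\<close>

lemma (in group) lower_central_series_subgroup:
  "subgroup (lower_central_series G c) G"
proof (induction c)
  case 0 show ?case by (simp add: subgroup_self)
next
  case (Suc c)
  then interpret L: subgroup "lower_central_series G c" G .
  show ?case by (auto intro!: generate_is_subgroup)
qed

text \<open>Inverses and generated subgroups computed inside \<open>H\<close> agree with those of
  \<open>G\<close>, so later commutator arguments can run in the ambient group.\<close>

lemma (in group) lower_central_series_carrier_Suc:
  assumes "subgroup H G"
  shows "lower_central_series (G\<lparr>carrier := H\<rparr>) (Suc c) =
    generate G {x \<otimes> y \<otimes> inv x \<otimes> inv y | x y.
      x \<in> lower_central_series (G\<lparr>carrier := H\<rparr>) c \<and> y \<in> H}"
    (is "_ = generate G ?C")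
proof -
  interpret K: group "G\<lparr>carrier := H\<rparr>" using subgroup_imp_group[OF assms] .
  interpret H: subgroup H G by fact
  have sub: "lower_central_series (G\<lparr>carrier := H\<rparr>) c \<subseteq> H"
    using subgroup.subset[OF K.lower_central_series_subgroup] by simp
  have eq: "{x \<otimes>\<^bsub>G\<lparr>carrier := H\<rparr>\<^esub> y \<otimes>\<^bsub>G\<lparr>carrier := H\<rparr>\<^esub> inv\<^bsub>G\<lparr>carrier := H\<rparr>\<^esub> x
      \<otimes>\<^bsub>G\<lparr>carrier := H\<rparr>\<^esub> inv\<^bsub>G\<lparr>carrier := H\<rparr>\<^esub> y | x y.
      x \<in> lower_central_series (G\<lparr>carrier := H\<rparr>) c \<and> y \<in> carrier (G\<lparr>carrier := H\<rparr>)} = ?C"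
    using sub by (force simp: m_inv_consistent[OF assms] subset_iff)
  have "?C \<subseteq> H" using sub by auto
  then show ?thesis
    using generate_consistent[OF _ assms] by (simp only: lower_central_series.simps eq)
qed

text \<open>Homomorphisms send commutators to commutators. Conversely a commutator in
  \<open>H\<close> lifts: the induction hypothesis lifts its first entry, surjectivity the
  second.\<close>

lemma (in group_hom) lower_central_series_img:
  assumes "h ` carrier G = carrier H"
  shows "lower_central_series H c = h ` lower_central_series G c"
proof (induction c)
  case 0 show ?case using assms by simp
next
  case (Suc c)
  interpret L: subgroup "lower_central_series G c" G by (rule G.lower_central_series_subgroup)
  have "{x \<otimes>\<^bsub>H\<^esub> y \<otimes>\<^bsub>H\<^esub> inv\<^bsub>H\<^esub> x \<otimes>\<^bsub>H\<^esub> inv\<^bsub>H\<^esub> y | x y. x \<in> lower_central_series H c \<and> y \<in> carrier H} =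
    h ` {x \<otimes> y \<otimes> inv x \<otimes> inv y | x y. x \<in> lower_central_series G c \<and> y \<in> carrier G}"
    (is "?A = h ` ?B")
  proof
    show "?A \<subseteq> h ` ?B"
    proof
      fix z assume "z \<in> ?A"
      then obtain x y where "z = x \<otimes>\<^bsub>H\<^esub> y \<otimes>\<^bsub>H\<^esub> inv\<^bsub>H\<^esub> x \<otimes>\<^bsub>H\<^esub> inv\<^bsub>H\<^esub> y"
        "x \<in> lower_central_series H c" "y \<in> carrier H" by blast
      moreover from this(2,3) obtain a b where "a \<in> lower_central_series G c" "x = h a"
        "b \<in> carrier G" "y = h b"
        unfolding Suc assms[symmetric] by (elim imageE)
      ultimately show "z \<in> h ` ?B"
        by (intro image_eqI[of _ _ "a \<otimes> b \<otimes> inv a \<otimes> inv b"]) auto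
    qed
    show "h ` ?B \<subseteq> ?A"
    proof
      fix z assume "z \<in> h ` ?B"
      then obtain a b where ab: "z = h (a \<otimes> b \<otimes> inv a \<otimes> inv b)"
        "a \<in> lower_central_series G c" "b \<in> carrier G" by blast
      then have "a \<in> carrier G" by simp
      with ab have "z = h a \<otimes>\<^bsub>H\<^esub> h b \<otimes>\<^bsub>H\<^esub> inv\<^bsub>H\<^esub> h a \<otimes>\<^bsub>H\<^esub> inv\<^bsub>H\<^esub> h b" by simp
      moreover have "h a \<in> lower_central_series H c" "h b \<in> carrier H" using ab by (auto simp: Suc)
      ultimately show "z \<in> ?A" by blast
    qed
  qed
  moreover have "?B \<subseteq> carrier G" by auto
  ultimately show ?case by (simp add: generate_img)
qed

lemma (in group_hom) lower_central_series_img_subgroup: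
  assumes "subgroup K G"
  shows "lower_central_series (H\<lparr>carrier := h ` K\<rparr>) c = h ` lower_central_series (G\<lparr>carrier := K\<rparr>) c"
proof -
  interpret K: subgroup K G by fact
  interpret hK: group_hom "G\<lparr>carrier := K\<rparr>" "H\<lparr>carrier := h ` K\<rparr>" h
  proof (intro group_hom.intro group_hom_axioms.intro)
    show "group (G\<lparr>carrier := K\<rparr>)" by (rule G.subgroup_imp_group[OF assms])
    show "group (H\<lparr>carrier := h ` K\<rparr>)"
      by (rule H.subgroup_imp_group[OF subgroup_img_is_subgroup[OF assms]])
    show "h \<in> hom (G\<lparr>carrier := K\<rparr>) (H\<lparr>carrier := h ` K\<rparr>)" by (rule homI) simp_all
  qed
  show ?thesis by (rule hK.lower_central_series_img) simp
qed

text \<open>The image lemma for the projection onto \<open>G Mod H\<close> turns nilpotency of a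
  factor group into an inclusion between subgroups of \<open>G\<close>; later arguments use this
  form and avoid cosets.\<close>

lemma (in normal) nilpotent_group_Mod_iff:
  "nilpotent_group (G Mod H) \<longleftrightarrow> (\<exists>c. lower_central_series G c \<subseteq> H)"
proof -
  interpret Q: group_hom G "G Mod H" "\<lambda>x. H #> x"
    by (intro group_hom.intro group_hom_axioms.intro r_coset_hom_Mod factorgroup_is_group is_group)
  have "lower_central_series (G Mod H) c = {H} \<longleftrightarrow> lower_central_series G c \<subseteq> H" for c
  proof -
    interpret L: subgroup "lower_central_series G c" G by (rule lower_central_series_subgroup)
    have "lower_central_series (G Mod H) c = (\<lambda>x. H #> x) ` lower_central_series G c"
      by (intro Q.lower_central_series_img) (simp add: carrier_FactGroup)
    moreover have "H #> x = H \<longleftrightarrow> x \<in> H" if "x \<in> lower_central_series G c" for x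
      using that coset_join1[of H x] coset_join2[of x H] subgroup_axioms L.subset by auto
    then have "(\<lambda>x. H #> x) ` lower_central_series G c \<subseteq> {H} \<longleftrightarrow> lower_central_series G c \<subseteq> H"
      by blast
    moreover have "lower_central_series G c \<noteq> {}" using L.one_closed by blast
    ultimately show ?thesis by (simp only: subset_singleton_iff image_is_empty) blast
  qed
  then show ?thesis by (simp add: nilpotent_group_def factorgroup_is_group)
qed

lemma (in group) nilpotent_subquotient_iff:
  assumes "subgroup H G" "K \<lhd> G" "K \<subseteq> H"
  shows "nilpotent_group (subquotient G H K) \<longleftrightarrow>
    (\<exists>c. lower_central_series (G\<lparr>carrier := H\<rparr>) c \<subseteq> K)"
  using normal.nilpotent_group_Mod_iff[OF normal_restrict_supergroup[OF assms]] .

text \<open>Conjugation is an automorphism, so it maps the commutator of \<open>a\<close> and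
  \<open>b\<close> to that of their conjugates, and both entries range over normal subgroups.
  Normality in the whole group is what lets the monolith property apply to these terms.\<close>

lemma (in group) lower_central_series_normal:
  assumes "H \<lhd> G"
  shows "lower_central_series (G\<lparr>carrier := H\<rparr>) c \<lhd> G"
proof (induction c)
  case 0 show ?case using assms by simp
next
  case (Suc c)
  let ?L = "lower_central_series (G\<lparr>carrier := H\<rparr>) c"
  interpret H: normal H G by fact
  interpret L: normal ?L G by (rule Suc)
  show ?case
    unfolding lower_central_series_carrier_Suc[OF H.subgroup_axioms]
  proof (rule normal_generateI)
    show "{x \<otimes> y \<otimes> inv x \<otimes> inv y |x y. x \<in> ?L \<and> y \<in> H} \<subseteq> carrier G" by auto
    fix h g assume h: "h \<in> {x \<otimes> y \<otimes> inv x \<otimes> inv y |x y. x \<in> ?L \<and> y \<in> H}" and g: "g \<in> carrier G"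
    from h obtain a b where ab: "h = a \<otimes> b \<otimes> inv a \<otimes> inv b" "a \<in> ?L" "b \<in> H" by blast
    let ?c = "\<lambda>x. g \<otimes> x \<otimes> inv g"
    have [simp]: "a \<in> carrier G" "b \<in> carrier G" using ab by auto
    have c: "?c x \<otimes> ?c y = ?c (x \<otimes> y)" if "x \<in> carrier G" "y \<in> carrier G" for x y
    proof -
      have "inv g \<otimes> (g \<otimes> (y \<otimes> inv g)) = y \<otimes> inv g"
        using that g by (simp add: m_assoc[symmetric])
      then show ?thesis using that g by (simp add: m_assoc)
    qed
    have ci: "inv (?c x) = ?c (inv x)" if "x \<in> carrier G" for x
      using that g by (simp add: inv_mult_group m_assoc)
    have "?c h = ?c a \<otimes> ?c b \<otimes> inv (?c a) \<otimes> inv (?c b)"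
      by (simp add: ci c ab(1) del: inv_mult_group)
    moreover have "?c a \<in> ?L" "?c b \<in> H" using ab g by (auto intro: L.inv_op_closed2 H.inv_op_closed2)
    ultimately show "?c h \<in> {x \<otimes> y \<otimes> inv x \<otimes> inv y |x y. x \<in> ?L \<and> y \<in> H}" by blast
  qed
qed

text \<open>The derived series read upwards has abelian factors. Hence the \<open>LEAST\<close> in
  \<open>nilpotency_length\<close> is attained for solvable groups.\<close>

lemma (in group) solvable_imp_nilpotent_series:
  assumes "solvable G"
  obtains h F where "nilpotent_series G h F"
proof -
  obtain m where m: "(derived G ^^ m) (carrier G) = {\<one>}"
    using assms solvable_iff_trivial_derived_seq by blast
  define D where "D i = (derived G ^^ i) (carrier G)" for i
  have normal: "D i \<lhd> G" for i
    by (induction i) (auto simp: D_def normal_self derived_is_normal)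
  have step: "D (Suc i) \<subseteq> D i" "nilpotent_group (subquotient G (D i) (D (Suc i)))" for i
  proof -
    interpret Di: normal "D i" G by (rule normal)
    have eq: "D (Suc i) = derived G (D i)" by (simp add: D_def)
    show sub: "D (Suc i) \<subseteq> D i"
      unfolding eq by (rule derived_incl[OF _ Di.subgroup_axioms]) simp
    \<comment> \<open>The first commutator term of \<open>D i\<close> lies in its derived subgroup,
      so the factor is nilpotent of class at most one.\<close>
    have "lower_central_series (G\<lparr>carrier := D i\<rparr>) (Suc 0) \<subseteq> D (Suc i)"
      unfolding lower_central_series_carrier_Suc[OF Di.subgroup_axioms] eq derived_def
      by (rule mono_generate) auto
    then show "nilpotent_group (subquotient G (D i) (D (Suc i)))"
      unfolding nilpotent_subquotient_iff[OF Di.subgroup_axioms normal sub] by blast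
  qed
  \<comment> \<open>The derived series descends, so \<open>m - i\<close> reverses the index.\<close>
  have "nilpotent_series G m (\<lambda>i. D (m - i))"
    unfolding nilpotent_series_def
  proof (intro conjI allI impI)
    fix i assume "i < m"
    then have "m - i = Suc (m - Suc i)" by simp
    then show "D (m - i) \<subseteq> D (m - Suc i)"
      "nilpotent_group (subquotient G (D (m - Suc i)) (D (m - i)))"
      using step[of "m - Suc i"] by simp_all
  qed (use m normal in \<open>auto simp: D_def\<close>)
  then show thesis by (rule that)
qed

section \<open>Images, fibres and preimages under a homomorphism\<close>

lemma (in group_hom) nilpotent_subquotient_img:
  assumes "nilpotent_group (subquotient G K L)" "K \<lhd> G" "L \<lhd> G" "L \<subseteq> K" "h ` carrier G = carrier H"
  shows "nilpotent_group (subquotient H (h ` K) (h ` L))"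
proof -
  interpret K: normal K G by fact
  interpret L: normal L G by fact
  have "subgroup (h ` K) H" by (rule subgroup_img_is_subgroup[OF K.subgroup_axioms])
  moreover have "h ` L \<lhd> H" by (rule L.surj_hom_normal_subgroup[OF group_hom_axioms assms(5)])
  moreover have "\<exists>c. lower_central_series (G\<lparr>carrier := K\<rparr>) c \<subseteq> L"
    using assms G.nilpotent_subquotient_iff K.subgroup_axioms by blast
  ultimately show ?thesis
    using assms(4) H.nilpotent_subquotient_iff[of "h ` K" "h ` L"]
      lower_central_series_img_subgroup[OF K.subgroup_axioms]
    by (metis image_mono)
qed

text \<open>The fibres over the image of \<open>K\<close> are cosets of the kernel, and they lie in
  \<open>K\<close> because the kernel does. Applied to the whole group and to a maximal subgroup
  containing the kernel.\<close>

lemma (in group_hom) card_eq_card_kernel_mult_card_img: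
  assumes "finite (carrier G)" "subgroup K G" "kernel G H h \<subseteq> K"
  shows "card K = card (kernel G H h) * card (h ` K)"
proof -
  interpret K: subgroup K G by fact
  have "card {x \<in> K. h x = h k} = card (kernel G H h)" if k: "k \<in> K" for k
  proof -
    have "bij_betw (\<lambda>x. x \<otimes> k) (kernel G H h) {x \<in> K. h x = h k}"
    proof (rule bij_betw_byWitness[where f' = "\<lambda>x. x \<otimes> inv k"])
      show "(\<lambda>x. x \<otimes> k) ` kernel G H h \<subseteq> {x \<in> K. h x = h k}"
      proof (clarify, intro conjI)
        fix x assume x: "x \<in> kernel G H h"
        then show "x \<otimes> k \<in> K" using assms(3) k by blast
        show "h (x \<otimes> k) = h k" using x k by (simp add: kernel_def)
      qed
      show "(\<lambda>x. x \<otimes> inv k) ` {x \<in> K. h x = h k} \<subseteq> kernel G H h"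
        using k by (auto simp: kernel_def)
    qed (use k in \<open>auto simp: G.m_assoc kernel_def\<close>)
    then show ?thesis by (simp add: bij_betw_same_card)
  qed
  moreover have "finite K" using assms(1) K.subset finite_subset by blast
  moreover have "card K = card (\<Union>y\<in>h ` K. {x \<in> K. h x = y})"
    by (rule arg_cong[where f = card]) auto
  moreover have "card (\<Union>y\<in>h ` K. {x \<in> K. h x = y}) = (\<Sum>y\<in>h ` K. card {x \<in> K. h x = y})"
    using \<open>finite K\<close> by (intro card_UN_disjoint) auto
  moreover have "(\<Sum>y\<in>h ` K. card {x \<in> K. h x = y}) = (\<Sum>y\<in>h ` K. card (kernel G H h))"
    using calculation(1) by (intro sum.cong) auto
  ultimately show ?thesis by simp
qed

lemma (in group_hom) subgroup_vimage:
  assumes "subgroup K H"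
  shows "subgroup {x \<in> carrier G. h x \<in> K} G"
proof -
  interpret K: subgroup K H by fact
  show ?thesis by unfold_locales (auto simp: G.m_inv_consistent)
qed

subsection \<open>Monolithic extensions\<close>

text \<open>\<open>E\<close> is an extension of \<open>G\<close> by a self-centralizing abelian \<open>p\<close>-group \<open>V\<close>
  that is the monolith (the unique minimal normal subgroup) of \<open>E\<close>.\<close>

locale monolithic_extension = group_hom E G \<pi>
  for E (structure) and G (structure) and \<pi> +
  fixes V and p d :: nat
  assumes kernel_eq: "kernel E G \<pi> = V"
    and finite_E: "finite (carrier E)"
    and surj: "\<pi> ` carrier E = carrier G"
    and nontrivial: "V \<noteq> {\<one>\<^bsub>E\<^esub>}"
    and monolith: "\<And>M. M \<lhd> E \<Longrightarrow> M \<noteq> {\<one>\<^bsub>E\<^esub>} \<Longrightarrow> V \<subseteq> M"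
    and abelian: "\<And>v w. v \<in> V \<Longrightarrow> w \<in> V \<Longrightarrow> v \<otimes>\<^bsub>E\<^esub> w = w \<otimes>\<^bsub>E\<^esub> v"
    and self_centralizing: "\<And>x. x \<in> carrier E \<Longrightarrow> (\<And>v. v \<in> V \<Longrightarrow> x \<otimes>\<^bsub>E\<^esub> v = v \<otimes>\<^bsub>E\<^esub> x) \<Longrightarrow> x \<in> V"
    and prime_p: "prime p"
    and card_V: "card V = p ^ d"
    and p_not_dvd_order: "\<not> p dvd order G"
begin

lemma normal_V: "V \<lhd> E"
  using normal_kernel by (simp add: kernel_eq)

lemma mem_V: "x \<in> carrier E \<Longrightarrow> \<pi> x = \<one>\<^bsub>G\<^esub> \<Longrightarrow> x \<in> V"
  unfolding kernel_eq[symmetric] by (simp add: kernel_def)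

lemma hom_V [simp]: "x \<in> V \<Longrightarrow> \<pi> x = \<one>\<^bsub>G\<^esub>"
  unfolding kernel_eq[symmetric] by (simp add: kernel_def)

sublocale V: normal V E by (rule normal_V)

lemma d_pos: "d > 0"
proof (rule ccontr)
  assume "\<not> d > 0"
  then have "card V = 1" using card_V by simp
  then show False using V.one_closed nontrivial by (metis card_1_singletonE singletonD)
qed

lemma order_eq: "order E = p ^ d * order G"
  using card_eq_card_kernel_mult_card_img[OF finite_E G.subgroup_self]
  by (simp add: surj kernel_eq card_V order_def V.subset)

lemma solvable_E:
  assumes "solvable G"
  shows "solvable E"
proof -
  interpret EV: group "E\<lparr>carrier := V\<rparr>" by (rule G.subgroup_imp_group[OF V.subgroup_axioms])
  have "comm_group (E\<lparr>carrier := V\<rparr>)"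
    by (rule EV.group_comm_groupI) (simp add: abelian)
  then have "(derived (E\<lparr>carrier := V\<rparr>) ^^ 1) (carrier (E\<lparr>carrier := V\<rparr>)) = {\<one>\<^bsub>E\<lparr>carrier := V\<rparr>\<^esub>}"
    by (simp add: comm_group.derived_eq_singleton)
  then have "solvable (E\<lparr>carrier := V\<rparr>)"
    using EV.solvable_iff_trivial_derived_seq by blast
  moreover have "group_hom (E\<lparr>carrier := V\<rparr>) E id"
    by (rule G.canonical_inj_is_hom[OF V.subgroup_axioms])
  ultimately show ?thesis
    by (intro solvable_condition[OF _ group_hom_axioms surj _ _ assms]) (auto simp: kernel_eq)
qed

text \<open>The last term of the lower central series of \<open>M\<close> containing \<open>V\<close> is followed by a normal
  subgroup of \<open>E\<close> not containing \<open>V\<close>, hence trivial; so \<open>M\<close> centralizes \<open>V\<close>.\<close>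

lemma nilpotent_normal_subset_V:
  assumes "M \<lhd> E" "lower_central_series (E\<lparr>carrier := M\<rparr>) c = {\<one>\<^bsub>E\<^esub>}"
  shows "M \<subseteq> V"
proof (cases "M = {\<one>\<^bsub>E\<^esub>}")
  case True then show ?thesis by simp
next
  case False
  let ?L = "lower_central_series (E\<lparr>carrier := M\<rparr>)"
  interpret M: normal M E by fact
  have "\<exists>i. V \<subseteq> ?L i \<and> \<not> V \<subseteq> ?L (Suc i)"
  proof (rule ccontr)
    assume "\<not> ?thesis"
    then have "V \<subseteq> ?L i" for i
      using monolith[OF assms(1) False] by (induction i) auto
    then have "V \<subseteq> {\<one>\<^bsub>E\<^esub>}" using assms(2) by metis
    then show False using nontrivial V.one_closed by blast
  qed
  then obtain i where i: "V \<subseteq> ?L i" "\<not> V \<subseteq> ?L (Suc i)" by blast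
  then have triv: "?L (Suc i) = {\<one>\<^bsub>E\<^esub>}"
    using monolith G.lower_central_series_normal[OF assms(1)] by blast
  show ?thesis
  proof
    fix x assume x: "x \<in> M"
    show "x \<in> V"
    proof (rule self_centralizing)
      fix v assume v: "v \<in> V"
      then have "v \<otimes>\<^bsub>E\<^esub> x \<otimes>\<^bsub>E\<^esub> inv\<^bsub>E\<^esub> v \<otimes>\<^bsub>E\<^esub> inv\<^bsub>E\<^esub> x \<in> ?L (Suc i)"
        unfolding G.lower_central_series_carrier_Suc[OF M.subgroup_axioms]
        using i(1) x by (intro generate.incl) blast
      then have "v \<otimes>\<^bsub>E\<^esub> x \<otimes>\<^bsub>E\<^esub> inv\<^bsub>E\<^esub> v \<otimes>\<^bsub>E\<^esub> inv\<^bsub>E\<^esub> x = \<one>\<^bsub>E\<^esub>" using triv by blast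
      then have "v \<otimes>\<^bsub>E\<^esub> x \<otimes>\<^bsub>E\<^esub> inv\<^bsub>E\<^esub> (x \<otimes>\<^bsub>E\<^esub> v) = \<one>\<^bsub>E\<^esub>"
        using v x by (simp add: G.inv_mult_group G.m_assoc)
      then have "v \<otimes>\<^bsub>E\<^esub> x = x \<otimes>\<^bsub>E\<^esub> v"
        using v x G.inv_equality[of "v \<otimes>\<^bsub>E\<^esub> x" "inv\<^bsub>E\<^esub> (x \<otimes>\<^bsub>E\<^esub> v)"]
        by (metis G.inv_closed G.inv_inv G.m_closed M.mem_carrier V.mem_carrier)
      then show "x \<otimes>\<^bsub>E\<^esub> v = v \<otimes>\<^bsub>E\<^esub> x" by simp
    qed (use x in simp)
  qed
qed

lemma nilpotent_series_quotient:
  assumes "nilpotent_series E h F"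
  obtains h' F' where "h = Suc h'" "nilpotent_series G h' F'"
proof (cases h)
  case 0
  \<comment> \<open>Length 0 would make \<open>E\<close> trivial, but \<open>V\<close> is
    not.\<close>
  then have "carrier E = {\<one>\<^bsub>E\<^esub>}" using assms unfolding nilpotent_series_def by metis
  then show thesis using V.subset V.one_closed nontrivial by blast
next
  case (Suc h')
  note F = assms[unfolded nilpotent_series_def Suc]
  have normal: "F i \<lhd> E" if "i \<le> Suc h'" for i using F that by blast
  have sub: "F i \<subseteq> F (Suc i)" "nilpotent_group (subquotient E (F (Suc i)) (F i))"
    if "i \<le> h'" for i using F that by (simp_all add: less_Suc_eq_le)
  interpret F1: normal "F 1" E by (rule normal) simp
  interpret L: subgroup "lower_central_series (E\<lparr>carrier := F 1\<rparr>) c" E for c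
    using G.lower_central_series_normal[OF F1.normal_axioms] normal_imp_subgroup by blast
  \<comment> \<open>Since \<open>F 0\<close> is trivial, nilpotency of the first factor is
    nilpotency of \<open>F 1\<close> itself.\<close>
  obtain c where "lower_central_series (E\<lparr>carrier := F 1\<rparr>) c \<subseteq> {\<one>\<^bsub>E\<^esub>}"
    using sub[of 0] F G.nilpotent_subquotient_iff[OF F1.subgroup_axioms G.one_is_normal] by force
  then have "lower_central_series (E\<lparr>carrier := F 1\<rparr>) c = {\<one>\<^bsub>E\<^esub>}"
    using L.one_closed by blast
  then have "F 1 \<subseteq> V" by (rule nilpotent_normal_subset_V[OF F1.normal_axioms])
  have "nilpotent_series G h' (\<lambda>i. \<pi> ` F (Suc i))"
    unfolding nilpotent_series_def
  proof (intro conjI allI impI)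
    show "\<pi> ` F (Suc 0) = {\<one>\<^bsub>G\<^esub>}"
    proof
      show "\<pi> ` F (Suc 0) \<subseteq> {\<one>\<^bsub>G\<^esub>}" using \<open>F 1 \<subseteq> V\<close> by auto
      show "{\<one>\<^bsub>G\<^esub>} \<subseteq> \<pi> ` F (Suc 0)" using F1.one_closed hom_one by force
    qed
    show "\<pi> ` F (Suc h') = carrier G" using F surj by simp
    show "\<pi> ` F (Suc i) \<lhd> G" if "i \<le> h'" for i
      using that by (intro normal.surj_hom_normal_subgroup[OF _ group_hom_axioms surj] normal) simp
    fix i assume i: "i < h'"
    then show "\<pi> ` F (Suc i) \<subseteq> \<pi> ` F (Suc (Suc i))" using sub(1)[of "Suc i"] by auto
    show "nilpotent_group (subquotient G (\<pi> ` F (Suc (Suc i))) (\<pi> ` F (Suc i)))"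
      using i by (intro nilpotent_subquotient_img sub normal surj) simp_all
  qed
  with Suc show thesis by (rule that)
qed

text \<open>If \<open>M\<close> contains \<open>V\<close>, its image is maximal in \<open>G\<close>,
  and a prime missed by the image is missed by \<open>M\<close>. Otherwise \<open>M\<close> is a
  complement of \<open>V\<close>, so its order is that of \<open>G\<close> and it misses
  \<open>p\<close>.\<close>

lemma maximal_subgroup_misses_prime:
  assumes max_G: "\<And>M. maximal_subgroup M G \<Longrightarrow> \<exists>r::nat. prime r \<and> r dvd order G \<and> \<not> r dvd card M"
    and M: "maximal_subgroup M E"
  shows "\<exists>r::nat. prime r \<and> r dvd order E \<and> \<not> r dvd card M"
proof -
  interpret M: subgroup M E using M by (simp add: maximal_subgroup_def)
  have M_max: "H = M \<or> H = carrier E" if "subgroup H E" "M \<subseteq> H" for H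
    using M that by (auto simp: maximal_subgroup_def)
  have ne: "M \<noteq> carrier E" using M by (simp add: maximal_subgroup_def)
  let ?P = "\<lambda>H. {x \<in> carrier E. \<pi> x \<in> H}"
  show ?thesis
  proof (cases "V \<subseteq> M")
    case True
    \<comment> \<open>\<open>M\<close> contains the kernel, so it is the full preimage of its
      image.\<close>
    have lift_mem: "x \<in> M" if x: "x \<in> carrier E" "\<pi> x \<in> \<pi> ` M" for x
    proof -
      obtain m where m: "m \<in> M" "\<pi> x = \<pi> m" using x(2) by (rule imageE)
      then have "x \<otimes>\<^bsub>E\<^esub> inv\<^bsub>E\<^esub> m \<in> V" using x(1) by (intro mem_V) simp_all
      then have "x \<otimes>\<^bsub>E\<^esub> inv\<^bsub>E\<^esub> m \<otimes>\<^bsub>E\<^esub> m \<in> M" using True m by blast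
      then show ?thesis using m x(1) by (simp add: G.m_assoc)
    qed
    have "maximal_subgroup (\<pi> ` M) G"
      unfolding maximal_subgroup_def
    proof (intro conjI allI impI)
      show "subgroup (\<pi> ` M) G" by (rule subgroup_img_is_subgroup[OF M.subgroup_axioms])
      show "\<pi> ` M \<noteq> carrier G"
        using lift_mem ne surj M.subset by blast
      fix H assume H: "subgroup H G" "\<pi> ` M \<subseteq> H"
      then have "?P H = M \<or> ?P H = carrier E"
        by (intro M_max subgroup_vimage) auto
      moreover have "\<pi> ` ?P H = \<pi> ` carrier E \<inter> H" by blast
      then have "\<pi> ` ?P H = H" using surj subgroup.subset[OF H(1)] by blast
      ultimately show "H = \<pi> ` M \<or> H = carrier G" using surj by metis
    qed
    then obtain r where r: "prime r" "r dvd order G" "\<not> r dvd card (\<pi> ` M)"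
      using max_G by blast
    have "card M = p ^ d * card (\<pi> ` M)"
      using card_eq_card_kernel_mult_card_img[OF finite_E M.subgroup_axioms] True
      by (simp add: kernel_eq card_V)
    moreover have "\<not> r dvd p"
      using r(1,2) prime_p p_not_dvd_order primes_dvd_imp_eq by blast
    ultimately have "\<not> r dvd card M"
      using r by (auto simp: prime_dvd_mult_iff dest: prime_dvd_power)
    moreover have "r dvd order E" using r(2) by (simp add: order_eq)
    ultimately show ?thesis using r(1) by blast
  next
    case False
    \<comment> \<open>This is the product of \<open>M\<close> and \<open>V\<close>, written as a
      full preimage. Maximality forces it to be all of \<open>E\<close>, so every element of
      \<open>E\<close> agrees with one of \<open>M\<close> modulo \<open>V\<close>.\<close>
    define Q where "Q = ?P (\<pi> ` M)"
    have "subgroup Q E"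
      unfolding Q_def by (intro subgroup_vimage subgroup_img_is_subgroup M.subgroup_axioms)
    moreover have "M \<subseteq> Q" by (auto simp: Q_def)
    moreover have "V \<subseteq> Q"
      using image_eqI[of "\<one>\<^bsub>G\<^esub>" \<pi> "\<one>\<^bsub>E\<^esub>" M] by (auto simp: Q_def)
    ultimately have "Q = carrier E"
      using M_max[of Q] False by metis
    then have lift: "\<exists>m\<in>M. \<pi> x = \<pi> m" if "x \<in> carrier E" for x
      using that unfolding Q_def by (metis (no_types, lifting) imageE mem_Collect_eq)
    \<comment> \<open>The intersection is normalized by \<open>M\<close> and centralized by the
      abelian \<open>V\<close>; each \<open>x\<close> factors as \<open>m\<close> times
      \<open>v\<close>, so it is normal. By the monolith property it is then trivial, which makes
      \<open>\<pi>\<close> injective on \<open>M\<close>.\<close>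
    have "M \<inter> V \<lhd> E"
    proof (rule G.normal_invI)
      show "subgroup (M \<inter> V) E"
        by (rule G.subgroups_Inter_pair[OF M.subgroup_axioms V.subgroup_axioms])
      fix x u assume x: "x \<in> carrier E" and u: "u \<in> M \<inter> V"
      obtain m where m: "m \<in> M" "\<pi> x = \<pi> m" using lift[OF x] by blast
      define v where "v = inv\<^bsub>E\<^esub> m \<otimes>\<^bsub>E\<^esub> x"
      have v: "v \<in> V" using x m by (auto simp: v_def intro: mem_V)
      have xmv: "x = m \<otimes>\<^bsub>E\<^esub> v" using x m by (simp add: v_def G.m_assoc[symmetric])
      have "v \<otimes>\<^bsub>E\<^esub> u \<otimes>\<^bsub>E\<^esub> inv\<^bsub>E\<^esub> v = u"
        using u v abelian[of v u] by (simp add: G.m_assoc)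
      moreover have "x \<otimes>\<^bsub>E\<^esub> u \<otimes>\<^bsub>E\<^esub> inv\<^bsub>E\<^esub> x = m \<otimes>\<^bsub>E\<^esub> (v \<otimes>\<^bsub>E\<^esub> u \<otimes>\<^bsub>E\<^esub> inv\<^bsub>E\<^esub> v) \<otimes>\<^bsub>E\<^esub> inv\<^bsub>E\<^esub> m"
        using u v m by (simp add: xmv G.m_assoc G.inv_mult_group)
      ultimately have "x \<otimes>\<^bsub>E\<^esub> u \<otimes>\<^bsub>E\<^esub> inv\<^bsub>E\<^esub> x = m \<otimes>\<^bsub>E\<^esub> u \<otimes>\<^bsub>E\<^esub> inv\<^bsub>E\<^esub> m" by simp
      moreover have "m \<otimes>\<^bsub>E\<^esub> u \<otimes>\<^bsub>E\<^esub> inv\<^bsub>E\<^esub> m \<in> M" using m u by simp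
      moreover have "x \<otimes>\<^bsub>E\<^esub> u \<otimes>\<^bsub>E\<^esub> inv\<^bsub>E\<^esub> x \<in> V" using x u by (simp add: V.inv_op_closed2)
      ultimately show "x \<otimes>\<^bsub>E\<^esub> u \<otimes>\<^bsub>E\<^esub> inv\<^bsub>E\<^esub> x \<in> M \<inter> V" by simp
    qed
    then have triv: "M \<inter> V = {\<one>\<^bsub>E\<^esub>}" using monolith False by blast
    have "inj_on \<pi> M"
    proof (rule inj_onI)
      fix x y assume xy: "x \<in> M" "y \<in> M" "\<pi> x = \<pi> y"
      then have "x \<otimes>\<^bsub>E\<^esub> inv\<^bsub>E\<^esub> y \<in> M \<inter> V" by (auto intro: mem_V)
      then have "x \<otimes>\<^bsub>E\<^esub> inv\<^bsub>E\<^esub> y = \<one>\<^bsub>E\<^esub>" using triv by blast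
      then show "x = y" using xy G.inv_equality[of x "inv\<^bsub>E\<^esub> y"] by simp
    qed
    moreover have "\<pi> ` M = carrier G"
    proof
      show "\<pi> ` M \<subseteq> carrier G" by auto
      show "carrier G \<subseteq> \<pi> ` M" unfolding surj[symmetric] using lift by blast
    qed
    ultimately have "card M = order G"
      unfolding order_def by (metis card_image)
    moreover have "p dvd order E" using d_pos by (simp add: order_eq)
    ultimately show ?thesis using prime_p p_not_dvd_order by metis
  qed
qed

text \<open>A nontrivial normal subgroup inside the monolith also contains it. This chief factor
  will witness the rank.\<close>

lemma chief_factor_V: "chief_factor E V {\<one>\<^bsub>E\<^esub>}"
  unfolding chief_factor_def
  using normal_V G.one_is_normal nontrivial V.one_closed monolith by blast

end

subsection \<open>Semidirect products\<close>

definition semidirect_product ::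
    "('v, 'm) monoid_scheme \<Rightarrow> ('g, 'n) monoid_scheme \<Rightarrow> ('g \<Rightarrow> 'v \<Rightarrow> 'v) \<Rightarrow> ('v \<times> 'g) monoid" where
  "semidirect_product V G act =
    \<lparr>carrier = carrier V \<times> carrier G,
     monoid.mult = (\<lambda>x y. (fst x \<otimes>\<^bsub>V\<^esub> act (snd x) (fst y), snd x \<otimes>\<^bsub>G\<^esub> snd y)),
     one = (\<one>\<^bsub>V\<^esub>, \<one>\<^bsub>G\<^esub>)\<rparr>"

text \<open>Modules are encoded as abelian groups on which \<open>G\<close> acts by automorphisms.
  Over a prime field every subgroup is a subspace, so invariant subgroups are exactly the
  submodules.\<close>

locale linear_action = V: comm_group V + G: group G for V (structure) and G (structure) +
  fixes act
  assumes act_closed [simp]: "\<And>g v. g \<in> carrier G \<Longrightarrow> v \<in> carrier V \<Longrightarrow> act g v \<in> carrier V"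
    and act_hom: "\<And>g v w. g \<in> carrier G \<Longrightarrow> v \<in> carrier V \<Longrightarrow> w \<in> carrier V \<Longrightarrow>
      act g (v \<otimes>\<^bsub>V\<^esub> w) = act g v \<otimes>\<^bsub>V\<^esub> act g w"
    and act_mult: "\<And>g h v. g \<in> carrier G \<Longrightarrow> h \<in> carrier G \<Longrightarrow> v \<in> carrier V \<Longrightarrow>
      act (g \<otimes>\<^bsub>G\<^esub> h) v = act g (act h v)"
    and act_one [simp]: "\<And>v. v \<in> carrier V \<Longrightarrow> act \<one>\<^bsub>G\<^esub> v = v"
begin

abbreviation E where "E \<equiv> semidirect_product V G act"

lemma act_unit [simp]: "g \<in> carrier G \<Longrightarrow> act g \<one>\<^bsub>V\<^esub> = \<one>\<^bsub>V\<^esub>"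
  using act_hom[of g "\<one>\<^bsub>V\<^esub>" "\<one>\<^bsub>V\<^esub>"] by (metis V.l_cancel_one V.l_one V.one_closed act_closed)

lemma act_inv_act [simp]:
  assumes "g \<in> carrier G" "v \<in> carrier V"
  shows "act (inv\<^bsub>G\<^esub> g) (act g v) = v" "act g (act (inv\<^bsub>G\<^esub> g) v) = v"
  using assms act_mult[of "inv\<^bsub>G\<^esub> g" g v] act_mult[of g "inv\<^bsub>G\<^esub> g" v] by simp_all

lemma semidirect_product_group: "group E"
proof (rule groupI)
  fix x y z assume "x \<in> carrier E" "y \<in> carrier E" "z \<in> carrier E"
  then show "x \<otimes>\<^bsub>E\<^esub> y \<otimes>\<^bsub>E\<^esub> z = x \<otimes>\<^bsub>E\<^esub> (y \<otimes>\<^bsub>E\<^esub> z)"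
    by (auto simp: semidirect_product_def act_hom act_mult V.m_assoc G.m_assoc)
next
  fix x assume "x \<in> carrier E"
  \<comment> \<open>The inverse of \<open>(v, g)\<close> pairs the inverse of \<open>g\<close> with
    its action on the inverse of \<open>v\<close>.\<close>
  then show "\<exists>y\<in>carrier E. y \<otimes>\<^bsub>E\<^esub> x = \<one>\<^bsub>E\<^esub>"
    by (intro bexI[of _ "(act (inv\<^bsub>G\<^esub> (snd x)) (inv\<^bsub>V\<^esub> fst x), inv\<^bsub>G\<^esub> (snd x))"])
      (auto simp: semidirect_product_def act_hom[symmetric])
qed (auto simp: semidirect_product_def)

text \<open>Serves to prove faithfulness: if nontrivial, this normal subgroup would contain the
  monolith of \<open>G\<close>.\<close>

lemma normal_kernel_action:
  "{g \<in> carrier G. \<forall>v\<in>carrier V. act g v = v} \<lhd> G" (is "?K \<lhd> G")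
proof (rule G.normal_invI)
  show "subgroup ?K G"
  proof
    fix g assume g: "g \<in> ?K"
    then have "act (inv\<^bsub>G\<^esub> g) v = v" if "v \<in> carrier V" for v
      using that act_inv_act(1)[of g v] by simp
    then show "inv\<^bsub>G\<^esub> g \<in> ?K" using g by simp
  qed (auto simp: act_mult)
  fix x g assume "x \<in> carrier G" "g \<in> ?K"
  then show "x \<otimes>\<^bsub>G\<^esub> g \<otimes>\<^bsub>G\<^esub> inv\<^bsub>G\<^esub> x \<in> ?K" by (simp add: act_mult)
qed

end

locale faithful_irreducible_action = linear_action +
  assumes finite_V: "finite (carrier V)"
    and nontrivial: "carrier V \<noteq> {\<one>\<^bsub>V\<^esub>}"
    and irreducible: "\<And>U. subgroup U V \<Longrightarrow> (\<And>g u. g \<in> carrier G \<Longrightarrow> u \<in> U \<Longrightarrow> act g u \<in> U) \<Longrightarrow>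
      U = {\<one>\<^bsub>V\<^esub>} \<or> U = carrier V"
    and faithful: "\<And>g. g \<in> carrier G \<Longrightarrow> (\<And>v. v \<in> carrier V \<Longrightarrow> act g v = v) \<Longrightarrow> g = \<one>\<^bsub>G\<^esub>"
begin

text \<open>A faithful action embeds \<open>G\<close> into the self-maps of \<open>V\<close>. The
  bound is crude but forces \<open>V\<close> to be large when \<open>G\<close> is.\<close>

lemma order_le: "order G \<le> order V ^ order V"
proof -
  have "inj_on (\<lambda>g. \<lambda>v\<in>carrier V. act g v) (carrier G)"
  proof (rule inj_onI)
    fix g h assume gh: "g \<in> carrier G" "h \<in> carrier G"
      and eq: "(\<lambda>v\<in>carrier V. act g v) = (\<lambda>v\<in>carrier V. act h v)"
    have "act (inv\<^bsub>G\<^esub> h \<otimes>\<^bsub>G\<^esub> g) v = v" if "v \<in> carrier V" for v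
      using gh that fun_cong[OF eq, of v] by (simp add: act_mult)
    then have "inv\<^bsub>G\<^esub> h \<otimes>\<^bsub>G\<^esub> g = \<one>\<^bsub>G\<^esub>" using gh by (intro faithful) simp_all
    then show "g = h" using gh by (metis G.inv_closed G.inv_equality G.inv_inv)
  qed
  moreover have "(\<lambda>g. \<lambda>v\<in>carrier V. act g v) ` carrier G \<subseteq> carrier V \<rightarrow>\<^sub>E carrier V" by auto
  ultimately have "card (carrier G) \<le> card (carrier V \<rightarrow>\<^sub>E carrier V)"
    using finite_V by (intro card_inj_on_le finite_PiE)
  then show ?thesis using finite_V by (simp add: order_def card_PiE)
qed

text \<open>Faithfulness makes the module its own centralizer. A normal \<open>M\<close> meets the
  module in a submodule, which by irreducibility is everything or trivial; in the trivial case
  \<open>M\<close> centralizes the module, hence lies in it and is itself trivial.\<close>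

lemma monolithic_extension_semidirect_product:
  assumes fin: "finite (carrier G)"
    and card: "order V = p ^ d" "prime p" "\<not> p dvd order G"
  shows "monolithic_extension E G snd (carrier V \<times> {\<one>\<^bsub>G\<^esub>}) p d"
proof -
  let ?V = "carrier V \<times> {\<one>\<^bsub>G\<^esub>}"
  interpret E: group E by (rule semidirect_product_group)
  interpret snd: group_hom E G snd
    by (intro group_hom.intro group_hom_axioms.intro E.is_group G.is_group homI)
      (auto simp: semidirect_product_def)
  have carrier_E: "carrier E = carrier V \<times> carrier G"
    and mult_E: "x \<otimes>\<^bsub>E\<^esub> y = (fst x \<otimes>\<^bsub>V\<^esub> act (snd x) (fst y), snd x \<otimes>\<^bsub>G\<^esub> snd y)"
    and one_E: "\<one>\<^bsub>E\<^esub> = (\<one>\<^bsub>V\<^esub>, \<one>\<^bsub>G\<^esub>)" for x y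
    by (simp_all add: semidirect_product_def)
  have kernel: "kernel E G snd = ?V" by (auto simp: kernel_def carrier_E)
  interpret V: normal ?V E using snd.normal_kernel by (simp add: kernel)
  have centralizer: "x \<in> ?V"
    if x: "x \<in> carrier E" and comm: "\<And>v. v \<in> ?V \<Longrightarrow> x \<otimes>\<^bsub>E\<^esub> v = v \<otimes>\<^bsub>E\<^esub> x" for x
  proof -
    obtain a g where ag: "x = (a, g)" "a \<in> carrier V" "g \<in> carrier G" using x by (auto simp: carrier_E)
    \<comment> \<open>Commuting with \<open>(v, \<one>)\<close> cancels \<open>a\<close>, as the
      module is abelian, and leaves \<open>g\<close> fixing \<open>v\<close>.\<close>
    have "act g v = v" if "v \<in> carrier V" for v
    proof -
      have "a \<otimes>\<^bsub>V\<^esub> act g v = v \<otimes>\<^bsub>V\<^esub> a" using comm[of "(v, \<one>\<^bsub>G\<^esub>)"] ag that by (simp add: mult_E)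
      then show ?thesis using ag that by (simp add: V.m_comm[of v a])
    qed
    then have "g = \<one>\<^bsub>G\<^esub>" by (intro faithful ag)
    then show ?thesis using ag by simp
  qed
  have monolith: "?V \<subseteq> M" if M: "M \<lhd> E" "M \<noteq> {\<one>\<^bsub>E\<^esub>}" for M
  proof -
    interpret M: normal M E by (rule M(1))
    define U where "U = {v \<in> carrier V. (v, \<one>\<^bsub>G\<^esub>) \<in> M}"
    have "subgroup U V"
    proof
      fix v w assume "v \<in> U" "w \<in> U"
      then show "v \<otimes>\<^bsub>V\<^esub> w \<in> U"
        using M.m_closed[of "(v, \<one>\<^bsub>G\<^esub>)" "(w, \<one>\<^bsub>G\<^esub>)"] by (simp add: U_def mult_E)
    next
      fix v assume v: "v \<in> U"
      have "inv\<^bsub>E\<^esub> (v, \<one>\<^bsub>G\<^esub>) = (inv\<^bsub>V\<^esub> v, \<one>\<^bsub>G\<^esub>)"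
        using v by (intro E.inv_equality) (auto simp: U_def mult_E one_E carrier_E)
      then show "inv\<^bsub>V\<^esub> v \<in> U"
        using v M.m_inv_closed[of "(v, \<one>\<^bsub>G\<^esub>)"] by (simp add: U_def)
    qed (use M.one_closed in \<open>auto simp: U_def one_E\<close>)
    \<comment> \<open>Conjugation by \<open>(\<one>, g)\<close> is the action of \<open>g\<close>,
      so normality of \<open>M\<close> makes \<open>U\<close> invariant.\<close>
    moreover have "act g v \<in> U" if g: "g \<in> carrier G" and v: "v \<in> U" for g v
    proof -
      have vV: "v \<in> carrier V" and vM: "(v, \<one>\<^bsub>G\<^esub>) \<in> M" using v by (simp_all add: U_def)
      have "inv\<^bsub>E\<^esub> (\<one>\<^bsub>V\<^esub>, g) = (\<one>\<^bsub>V\<^esub>, inv\<^bsub>G\<^esub> g)"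
        using g by (intro E.inv_equality) (auto simp: mult_E one_E carrier_E)
      then have "(\<one>\<^bsub>V\<^esub>, g) \<otimes>\<^bsub>E\<^esub> (v, \<one>\<^bsub>G\<^esub>) \<otimes>\<^bsub>E\<^esub> inv\<^bsub>E\<^esub> (\<one>\<^bsub>V\<^esub>, g) = (act g v, \<one>\<^bsub>G\<^esub>)"
        using g vV by (simp add: mult_E)
      moreover have "(\<one>\<^bsub>V\<^esub>, g) \<in> carrier E" using g by (simp add: carrier_E)
      ultimately have "(act g v, \<one>\<^bsub>G\<^esub>) \<in> M" using M.inv_op_closed2[OF _ vM] by metis
      then show ?thesis using g vV by (simp add: U_def)
    qed
    ultimately have "U = {\<one>\<^bsub>V\<^esub>} \<or> U = carrier V" by (rule irreducible)
    then show ?thesis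
    proof
      assume "U = carrier V"
      then show ?thesis by (auto simp: U_def)
    next
      assume "U = {\<one>\<^bsub>V\<^esub>}"
      then have inter: "M \<inter> ?V \<subseteq> {\<one>\<^bsub>E\<^esub>}" by (force simp: U_def one_E)
      \<comment> \<open>The commutator of \<open>x\<close> in \<open>M\<close> with \<open>v\<close>
        in the module lies in both normal subgroups, as its two bracketings show. Their intersection
        is trivial, so \<open>x\<close> commutes with \<open>v\<close>.\<close>
      have "M \<subseteq> ?V"
      proof
        fix x assume x: "x \<in> M"
        show "x \<in> ?V"
        proof (rule centralizer)
          fix v assume v: "v \<in> ?V"
          have "(x \<otimes>\<^bsub>E\<^esub> v \<otimes>\<^bsub>E\<^esub> inv\<^bsub>E\<^esub> x) \<otimes>\<^bsub>E\<^esub> inv\<^bsub>E\<^esub> v \<in> ?V"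
            using x v by (intro V.m_closed V.inv_op_closed2 V.m_inv_closed M.mem_carrier)
          moreover have "x \<otimes>\<^bsub>E\<^esub> (v \<otimes>\<^bsub>E\<^esub> inv\<^bsub>E\<^esub> x \<otimes>\<^bsub>E\<^esub> inv\<^bsub>E\<^esub> v) \<in> M"
            using x v by (intro M.m_closed M.inv_op_closed2 M.m_inv_closed V.mem_carrier)
          moreover have "x \<otimes>\<^bsub>E\<^esub> (v \<otimes>\<^bsub>E\<^esub> inv\<^bsub>E\<^esub> x \<otimes>\<^bsub>E\<^esub> inv\<^bsub>E\<^esub> v) = (x \<otimes>\<^bsub>E\<^esub> v \<otimes>\<^bsub>E\<^esub> inv\<^bsub>E\<^esub> x) \<otimes>\<^bsub>E\<^esub> inv\<^bsub>E\<^esub> v"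
            using M.mem_carrier[OF x] V.mem_carrier[OF v] by (simp add: E.m_assoc)
          ultimately have "(x \<otimes>\<^bsub>E\<^esub> v \<otimes>\<^bsub>E\<^esub> inv\<^bsub>E\<^esub> x) \<otimes>\<^bsub>E\<^esub> inv\<^bsub>E\<^esub> v = \<one>\<^bsub>E\<^esub>"
            using inter by auto
          then have "x \<otimes>\<^bsub>E\<^esub> v \<otimes>\<^bsub>E\<^esub> inv\<^bsub>E\<^esub> x = v"
            using M.mem_carrier[OF x] V.mem_carrier[OF v]
            by (metis E.inv_closed E.inv_equality E.inv_inv E.m_closed)
          then show "x \<otimes>\<^bsub>E\<^esub> v = v \<otimes>\<^bsub>E\<^esub> x"
            using M.mem_carrier[OF x] V.mem_carrier[OF v]
            by (metis E.inv_solve_right' E.m_closed)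
        qed (use x M.mem_carrier in blast)
      qed
      then show ?thesis using inter M(2) M.one_closed by blast
    qed
  qed
  show ?thesis
  proof unfold_locales
    show "finite (carrier E)" using finite_V fin by (simp add: carrier_E)
    show "snd ` carrier E = carrier G" using V.one_closed by (force simp: carrier_E)
    show "?V \<noteq> {\<one>\<^bsub>E\<^esub>}"
    proof
      assume "?V = {\<one>\<^bsub>E\<^esub>}"
      then have "fst ` ?V = fst ` {\<one>\<^bsub>E\<^esub>}" by (rule arg_cong)
      then show False using nontrivial by (simp add: one_E)
    qed
    show "v \<otimes>\<^bsub>E\<^esub> w = w \<otimes>\<^bsub>E\<^esub> v" if "v \<in> ?V" "w \<in> ?V" for v w
      using that by (auto simp: mult_E V.m_comm)
    show "card ?V = p ^ d" using card(1) by (simp add: order_def card_cartesian_product)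
  qed (use kernel card monolith centralizer in blast)+
qed

end

text \<open>Each semidirect product has a larger element type; this moves the structure back to a
  copy over the natural numbers, so that the induction stays in one type.\<close>

lemma (in monolithic_extension) iso_transport:
  assumes "group E'" "\<phi> \<in> iso E' E"
  shows "monolithic_extension E' G (\<pi> \<circ> \<phi>) (kernel E' G (\<pi> \<circ> \<phi>)) p d"
proof -
  interpret E': group E' by fact
  interpret \<phi>: group_hom E' E \<phi>
    using assms by (intro group_hom.intro group_hom_axioms.intro G.is_group) (auto simp: iso_def)
  interpret \<pi>\<phi>: group_hom E' G "\<pi> \<circ> \<phi>"
    by (intro group_hom.intro group_hom_axioms.intro H.is_group E'.is_group homI) simp_all
  have bij: "bij_betw \<phi> (carrier E') (carrier E)" using assms(2) by (simp add: iso_def)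
  then have onto: "\<phi> ` carrier E' = carrier E" and inj: "inj_on \<phi> (carrier E')"
    by (simp_all add: bij_betw_def)
  define V' where "V' = kernel E' G (\<pi> \<circ> \<phi>)"
  have V': "V' = {x \<in> carrier E'. \<phi> x \<in> V}"
    unfolding V'_def kernel_eq[symmetric] by (auto simp: kernel_def)
  have img: "\<phi> ` V' = V" using onto V.subset by (auto simp: V')
  have inj_V': "inj_on \<phi> V'" by (rule inj_on_subset[OF inj]) (auto simp: V')
  have eqI: "x = y" if "x \<in> carrier E'" "y \<in> carrier E'" "\<phi> x = \<phi> y" for x y
    using inj that by (auto dest: inj_onD)
  show ?thesis
    unfolding V'_def[symmetric]
  proof (unfold_locales)
    show "kernel E' G (\<pi> \<circ> \<phi>) = V'" by (simp add: V'_def)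
    show "finite (carrier E')" using bij finite_E bij_betw_finite by blast
    show "(\<pi> \<circ> \<phi>) ` carrier E' = carrier G" by (simp only: image_comp[symmetric] onto surj)
    show "V' \<noteq> {\<one>\<^bsub>E'\<^esub>}"
    proof
      assume "V' = {\<one>\<^bsub>E'\<^esub>}"
      then have "V = {\<one>\<^bsub>E\<^esub>}" unfolding img[symmetric] by simp
      then show False using nontrivial by simp
    qed
    show "V' \<subseteq> M" if M: "M \<lhd> E'" "M \<noteq> {\<one>\<^bsub>E'\<^esub>}" for M
    proof
      interpret M: normal M E' by (rule M(1))
      have "\<phi> ` M \<lhd> E" by (rule M.surj_hom_normal_subgroup[OF \<phi>.group_hom_axioms onto])
      moreover have "\<phi> ` M \<noteq> {\<one>\<^bsub>E\<^esub>}"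
      proof
        assume eq: "\<phi> ` M = {\<one>\<^bsub>E\<^esub>}"
        have "x = \<one>\<^bsub>E'\<^esub>" if "x \<in> M" for x
          using eq that by (intro eqI) auto
        then show False using M(2) M.one_closed by blast
      qed
      ultimately have sub: "V \<subseteq> \<phi> ` M" by (rule monolith)
      fix x assume "x \<in> V'"
      then have x: "x \<in> carrier E'" "\<phi> x \<in> \<phi> ` M" using sub by (auto simp: V')
      then obtain m where "m \<in> M" "\<phi> x = \<phi> m" by blast
      then show "x \<in> M" using eqI[of x m] x(1) by simp
    qed
    show "v \<otimes>\<^bsub>E'\<^esub> w = w \<otimes>\<^bsub>E'\<^esub> v" if "v \<in> V'" "w \<in> V'" for v w
      using that abelian[of "\<phi> v" "\<phi> w"] by (intro eqI) (auto simp: V')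
    show "x \<in> V'" if x: "x \<in> carrier E'" and comm: "\<And>v. v \<in> V' \<Longrightarrow> x \<otimes>\<^bsub>E'\<^esub> v = v \<otimes>\<^bsub>E'\<^esub> x" for x
    proof -
      have "\<phi> x \<in> V"
      proof (rule self_centralizing)
        fix w assume "w \<in> V"
        then obtain v where v: "v \<in> V'" "w = \<phi> v" unfolding img[symmetric] by blast
        then have "\<phi> (x \<otimes>\<^bsub>E'\<^esub> v) = \<phi> (v \<otimes>\<^bsub>E'\<^esub> x)" using comm by simp
        then show "\<phi> x \<otimes>\<^bsub>E\<^esub> w = w \<otimes>\<^bsub>E\<^esub> \<phi> x" using v x by (simp add: V')
      qed (use x in simp)
      then show ?thesis using x by (simp add: V')
    qed
    show "card V' = p ^ d" using card_image[OF inj_V'] by (simp add: img card_V)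
  qed (fact prime_p p_not_dvd_order)+
qed

subsection \<open>Faithful irreducible modules\<close>

text \<open>Right translation on functions, which is a left action: applying \<open>h\<close> and
  then \<open>g\<close> evaluates at \<open>x \<otimes> g \<otimes> h\<close>. With values modulo
  \<open>p\<close> it is the regular module; the restriction to the carrier keeps functions
  extensional, as \<open>product_group\<close> demands.\<close>

definition translate :: "('g, 'm) monoid_scheme \<Rightarrow> 'g \<Rightarrow> ('g \<Rightarrow> int) \<Rightarrow> 'g \<Rightarrow> int" where
  "translate G g f = (\<lambda>x\<in>carrier G. f (x \<otimes>\<^bsub>G\<^esub> g))"

lemma (in group) linear_action_translate:
  fixes p :: nat
  defines "A \<equiv> product_group (carrier G) (\<lambda>_. integer_mod_group p)"
  assumes "subgroup U A" "\<And>g u. g \<in> carrier G \<Longrightarrow> u \<in> U \<Longrightarrow> translate G g u \<in> U"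
  shows "linear_action (A\<lparr>carrier := U\<rparr>) G (translate G)"
proof -
  interpret A: group A by (simp add: A_def)
  interpret A: comm_group A
    by (rule A.group_comm_groupI) (auto simp: A_def add.commute)
  interpret U: subgroup U A by fact
  interpret AU: group "A\<lparr>carrier := U\<rparr>" by (rule A.subgroup_imp_group[OF U.subgroup_axioms])
  interpret AU: comm_group "A\<lparr>carrier := U\<rparr>"
    by (rule AU.group_comm_groupI) (simp add: A.m_comm)
  have ext: "f \<in> extensional (carrier G)" if "f \<in> U" for f
    using U.mem_carrier[OF that] by (auto simp: A_def PiE_iff)
  show ?thesis
  proof unfold_locales
    fix g v w assume "g \<in> carrier G" "v \<in> carrier (A\<lparr>carrier := U\<rparr>)" "w \<in> carrier (A\<lparr>carrier := U\<rparr>)"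
    then show "translate G g (v \<otimes>\<^bsub>A\<lparr>carrier := U\<rparr>\<^esub> w) =
        translate G g v \<otimes>\<^bsub>A\<lparr>carrier := U\<rparr>\<^esub> translate G g w"
      by (auto simp: translate_def A_def intro!: restrict_ext)
  next
    fix g h v assume "g \<in> carrier G" "h \<in> carrier G" "v \<in> carrier (A\<lparr>carrier := U\<rparr>)"
    then show "translate G (g \<otimes> h) v = translate G g (translate G h v)"
      by (auto simp: translate_def m_assoc intro!: restrict_ext)
  next
    fix v assume "v \<in> carrier (A\<lparr>carrier := U\<rparr>)"
    then show "translate G \<one> v = v"
      using ext by (auto simp: translate_def intro!: extensionalityI[of _ "carrier G"])
  qed (use assms(3) in simp_all)
qed

text \<open>A minimal nonzero submodule \<open>U\<close> of \<open>A\<^sub>0\<close> inside the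
  regular module is irreducible. If the action on \<open>U\<close> had a nontrivial kernel, this
  would contain \<open>H\<close>, so \<open>H\<close> would fix all of \<open>U\<close>, contrary to
  the choice of \<open>A\<^sub>0\<close>.\<close>

lemma (in normal) exists_faithful_irreducible_module:
  fixes p :: nat
  assumes finite: "finite (carrier G)"
    and nontrivial: "H \<noteq> {\<one>}"
    and monolith: "\<And>M. M \<lhd> G \<Longrightarrow> M \<noteq> {\<one>} \<Longrightarrow> H \<subseteq> M"
    and p: "prime p" "\<not> p dvd order G"
  obtains V :: "('a \<Rightarrow> int) monoid" and act d where
    "faithful_irreducible_action V G act" "order V = p ^ d"
proof -
  have p1: "p > 1" using p(1) prime_gt_1_nat by blast
  define A where "A = product_group (carrier G) (\<lambda>_. integer_mod_group p)"
  have carrier_A: "carrier A = carrier G \<rightarrow>\<^sub>E {0..<int p}"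
    and mult_A: "f \<otimes>\<^bsub>A\<^esub> g = (\<lambda>x\<in>carrier G. (f x + g x) mod int p)"
    and one_A: "\<one>\<^bsub>A\<^esub> = (\<lambda>x\<in>carrier G. 0)" for f g
    using p1 by (simp_all add: A_def carrier_integer_mod_group)
  interpret A: group A by (simp add: A_def)
  have inv_A: "inv\<^bsub>A\<^esub> f = (\<lambda>x\<in>carrier G. (- f x) mod int p)" if "f \<in> carrier A" for f
  proof -
    have "f \<in> (\<Pi>\<^sub>E i\<in>carrier G. carrier (integer_mod_group p))" using that by (simp add: A_def)
    then show ?thesis unfolding A_def by (subst inv_product_group) (auto intro!: restrict_ext inv_integer_mod_group dest: PiE_mem)
  qed
  have fin_A: "finite (carrier A)" using finite by (simp add: carrier_A finite_PiE)
  have order_A: "order A = p ^ order G" by (simp add: order_def carrier_A card_PiE finite)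
  \<comment> \<open>the kernel of averaging over \<open>H\<close>: since \<open>p\<close> does not divide \<open>card H\<close>, it contains no nonzero
    vector fixed by \<open>H\<close>, so \<open>H\<close> acts nontrivially on each of its nonzero submodules\<close>
  define A\<^sub>0 where "A\<^sub>0 = {f \<in> carrier A. \<forall>x\<in>carrier G. int p dvd (\<Sum>n\<in>H. f (x \<otimes> n))}"
  have fixed_zero: "f = \<one>\<^bsub>A\<^esub>"
    if f: "f \<in> A\<^sub>0" and fixed: "\<And>n. n \<in> H \<Longrightarrow> translate G n f = f" for f
  proof (rule extensionalityI[of _ "carrier G"])
    show "f \<in> extensional (carrier G)" using f by (simp add: A\<^sub>0_def carrier_A PiE_iff)
    show "\<one>\<^bsub>A\<^esub> \<in> extensional (carrier G)" by (simp add: one_A)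
    fix x assume x: "x \<in> carrier G"
    have "f (x \<otimes> n) = f x" if "n \<in> H" for n
      using fun_cong[OF fixed[OF that], of x] x by (simp add: translate_def)
    \<comment> \<open>A fixed \<open>f\<close> is constant on the coset of \<open>x\<close>, so its
      sum there is \<open>card H\<close> times \<open>f x\<close>.\<close>
    then have "int p dvd int (card H) * f x" using f x by (auto simp: A\<^sub>0_def)
    moreover have "\<not> p dvd card H"
      using p(2) lagrange[OF subgroup_axioms] by (metis dvd_mult)
    ultimately have "int p dvd f x" using p(1) by (simp add: prime_dvd_mult_iff)
    \<comment> \<open>Values are representatives between 0 and \<open>p - 1\<close>, so divisibility
      by \<open>p\<close> means zero.\<close>
    moreover have "0 \<le> f x" "f x < int p" using f x by (auto simp: A\<^sub>0_def carrier_A PiE_iff)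
    ultimately have "f x = 0" by (metis dvd_imp_mod_0 mod_pos_pos_trivial)
    then show "f x = \<one>\<^bsub>A\<^esub> x" using x by (simp add: one_A)
  qed
  have A\<^sub>0_subgroup: "subgroup A\<^sub>0 A"
  proof
    show "A\<^sub>0 \<subseteq> carrier A" by (auto simp: A\<^sub>0_def)
    show "\<one>\<^bsub>A\<^esub> \<in> A\<^sub>0" using A.one_closed by (simp add: A\<^sub>0_def) (simp add: one_A)
  next
    fix f g assume fg: "f \<in> A\<^sub>0" "g \<in> A\<^sub>0"
    have "int p dvd (\<Sum>n\<in>H. (f (x \<otimes> n) + g (x \<otimes> n)) mod int p)" if "x \<in> carrier G" for x
    proof -
      have "int p dvd (\<Sum>n\<in>H. f (x \<otimes> n)) + (\<Sum>n\<in>H. g (x \<otimes> n))"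
        using fg that by (auto simp: A\<^sub>0_def)
      then show ?thesis by (simp add: dvd_eq_mod_eq_0 mod_sum_eq sum.distrib)
    qed
    then show "f \<otimes>\<^bsub>A\<^esub> g \<in> A\<^sub>0"
      using fg A.m_closed[of f g] by (simp add: A\<^sub>0_def) (simp add: mult_A)
  next
    fix f assume f: "f \<in> A\<^sub>0"
    have "int p dvd (\<Sum>n\<in>H. (- f (x \<otimes> n)) mod int p)" if "x \<in> carrier G" for x
    proof -
      have "int p dvd - (\<Sum>n\<in>H. f (x \<otimes> n))" using f that by (simp add: A\<^sub>0_def)
      then show ?thesis by (simp add: dvd_eq_mod_eq_0 mod_sum_eq sum_negf)
    qed
    then show "inv\<^bsub>A\<^esub> f \<in> A\<^sub>0"
      using f A.inv_closed[of f] by (simp add: A\<^sub>0_def inv_A) 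
  qed
  have A\<^sub>0_invariant: "translate G g f \<in> A\<^sub>0" if g: "g \<in> carrier G" and f: "f \<in> A\<^sub>0" for g f
  proof -
    have "translate G g f \<in> carrier A" using f g by (auto simp: A\<^sub>0_def translate_def carrier_A)
    moreover have "int p dvd (\<Sum>n\<in>H. translate G g f (x \<otimes> n))" if x: "x \<in> carrier G" for x
    proof -
      \<comment> \<open>Normality of \<open>H\<close> allows the substitution of \<open>n\<close> by
        its conjugate under \<open>g\<close>, which turns the sum over \<open>x H g\<close> into the
        one over \<open>x g H\<close>.\<close>
      have "(\<Sum>n\<in>H. translate G g f (x \<otimes> n)) = (\<Sum>n\<in>H. f (x \<otimes> g \<otimes> n))"
      proof (rule sum.reindex_bij_witness[where i = "\<lambda>n. g \<otimes> n \<otimes> inv g" and j = "\<lambda>n. inv g \<otimes> n \<otimes> g"])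
        fix n assume n: "n \<in> H"
        have "g \<otimes> (inv g \<otimes> n) = n" "inv g \<otimes> (g \<otimes> n) = n"
          using n g by (simp_all add: m_assoc[symmetric])
        then show "g \<otimes> (inv g \<otimes> n \<otimes> g) \<otimes> inv g = n" "inv g \<otimes> (g \<otimes> n \<otimes> inv g) \<otimes> g = n"
          using n g by (simp_all add: m_assoc)
        show "inv g \<otimes> n \<otimes> g \<in> H" "g \<otimes> n \<otimes> inv g \<in> H"
          using n g by (simp_all add: inv_op_closed1 inv_op_closed2)
        have "x \<otimes> g \<otimes> (inv g \<otimes> n \<otimes> g) = x \<otimes> (g \<otimes> inv g) \<otimes> n \<otimes> g"
          using n g x by (simp only: m_assoc m_closed inv_closed mem_carrier)
        then show "f (x \<otimes> g \<otimes> (inv g \<otimes> n \<otimes> g)) = translate G g f (x \<otimes> n)"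
          using n g x by (simp add: translate_def)
      qed
      then show ?thesis using f g x by (simp add: A\<^sub>0_def)
    qed
    ultimately show ?thesis by (simp add: A\<^sub>0_def)
  qed
  have A\<^sub>0_nontrivial: "A\<^sub>0 \<noteq> {\<one>\<^bsub>A\<^esub>}"
  proof -
    obtain m where m: "m \<in> H" "m \<noteq> \<one>"
      using nontrivial subgroup.one_closed[OF subgroup_axioms] by blast
    \<comment> \<open>The indicator of the identity minus that of \<open>m\<close>, with -1
      represented by \<open>p - 1\<close>. Both points lie in \<open>H\<close>, so the values on
      each coset sum to \<open>p\<close> or 0.\<close>
    define f where "f = (\<lambda>x\<in>carrier G. if x = \<one> then 1 else if x = m then int p - 1 else 0)"
    have fin_H: "finite H" using finite subset finite_subset by blast
    have "(\<Sum>n\<in>H. f (x \<otimes> n)) = (if x \<in> H then int p else 0)" if x: "x \<in> carrier G" for x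
    proof -
      have "(\<Sum>n\<in>H. f (x \<otimes> n)) = (\<Sum>n\<in>H. (if n = inv x then 1 else 0) + (if n = inv x \<otimes> m then int p - 1 else 0))"
      proof (rule sum.cong[OF refl])
        fix n assume n: "n \<in> H"
        have carrier: "n \<in> carrier G" "m \<in> carrier G" using n m by auto
        have solve: "x \<otimes> n = y \<longleftrightarrow> n = inv x \<otimes> y" if "y \<in> carrier G" for y
          using inv_solve_left[OF carrier(1) x that] by (simp only: eq_commute[of y])
        have "x \<otimes> n = \<one> \<longleftrightarrow> n = inv x" "x \<otimes> n = m \<longleftrightarrow> n = inv x \<otimes> m"
          using solve[OF one_closed] solve[OF carrier(2)] x by simp_all
        \<comment> \<open>As \<open>m\<close> is not the identity, the two indicators never hold
          together, and the nested conditional splits into a sum.\<close>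
        moreover have "inv x = inv x \<otimes> m \<longleftrightarrow> m = \<one>" using x m by simp
        ultimately show "f (x \<otimes> n) = (if n = inv x then 1 else 0) + (if n = inv x \<otimes> m then int p - 1 else 0)"
          using x n m by (auto simp: f_def)
      qed
      also have "\<dots> = (if inv x \<in> H then 1 else 0) + (if inv x \<otimes> m \<in> H then int p - 1 else 0)"
        using fin_H by (simp add: sum.distrib)
      also have "inv x \<in> H \<longleftrightarrow> x \<in> H"
        using x m_inv_closed[of x] m_inv_closed[of "inv x"] by auto
      also have "inv x \<otimes> m \<in> H \<longleftrightarrow> x \<in> H"
      proof
        assume "inv x \<otimes> m \<in> H"
        then have "m \<otimes> inv (inv x \<otimes> m) \<in> H"
          by (rule subgroup.m_closed[OF subgroup_axioms m(1) m_inv_closed])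
        then show "x \<in> H" using x m(1) by (simp add: inv_mult_group m_assoc[symmetric])
      qed (intro subgroup.m_closed[OF subgroup_axioms] m m_inv_closed)
      finally show ?thesis by simp
    qed
    then have "f \<in> A\<^sub>0" using p1 by (auto simp: A\<^sub>0_def carrier_A f_def)
    moreover have "f \<noteq> \<one>\<^bsub>A\<^esub>"
    proof
      assume "f = \<one>\<^bsub>A\<^esub>"
      then have "f \<one> = \<one>\<^bsub>A\<^esub> \<one>" by simp
      then show False by (simp add: f_def one_A)
    qed
    ultimately show ?thesis by blast
  qed
  define P where "P U \<longleftrightarrow> subgroup U A \<and> U \<subseteq> A\<^sub>0 \<and> U \<noteq> {\<one>\<^bsub>A\<^esub>} \<and>
    (\<forall>g\<in>carrier G. \<forall>u\<in>U. translate G g u \<in> U)" for U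
  have "P A\<^sub>0" using A\<^sub>0_subgroup A\<^sub>0_invariant A\<^sub>0_nontrivial by (simp add: P_def)
  then obtain U where U: "P U" and minimal: "\<And>W. P W \<Longrightarrow> card U \<le> card W"
    using ex_has_least_nat[of P A\<^sub>0 card] by blast
  have U_sub: "subgroup U A" "U \<subseteq> A\<^sub>0" "U \<noteq> {\<one>\<^bsub>A\<^esub>}"
    and U_inv: "\<And>g u. g \<in> carrier G \<Longrightarrow> u \<in> U \<Longrightarrow> translate G g u \<in> U"
    using U by (simp_all add: P_def)
  have fin_U: "finite U" using fin_A subgroup.subset[OF U_sub(1)] finite_subset by blast
  interpret act: linear_action "A\<lparr>carrier := U\<rparr>" G "translate G"
    using U_sub(1) U_inv unfolding A_def by (rule linear_action_translate)
  have "order (A\<lparr>carrier := U\<rparr>) dvd p ^ order G"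
    using A.lagrange[OF U_sub(1)] unfolding order_A[symmetric] by (simp add: order_def) (metis dvd_triv_right)
  then obtain d where d: "order (A\<lparr>carrier := U\<rparr>) = p ^ d"
    using divides_primepow_nat[OF p(1)] by blast
  have "faithful_irreducible_action (A\<lparr>carrier := U\<rparr>) G (translate G)"
  proof unfold_locales
    show "finite (carrier (A\<lparr>carrier := U\<rparr>))" using fin_U by simp
    show "carrier (A\<lparr>carrier := U\<rparr>) \<noteq> {\<one>\<^bsub>A\<lparr>carrier := U\<rparr>\<^esub>}" using U_sub by simp
    fix W assume W: "subgroup W (A\<lparr>carrier := U\<rparr>)"
      and W_inv: "\<And>g u. g \<in> carrier G \<Longrightarrow> u \<in> W \<Longrightarrow> translate G g u \<in> W"
    have WU: "W \<subseteq> U" using subgroup.subset[OF W] by simp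
    show "W = {\<one>\<^bsub>A\<lparr>carrier := U\<rparr>\<^esub>} \<or> W = carrier (A\<lparr>carrier := U\<rparr>)"
    proof (cases "W = {\<one>\<^bsub>A\<^esub>}")
      case False
      then have "P W"
        using A.incl_subgroup[OF U_sub(1) W] W_inv WU U_sub(2) by (simp add: P_def)
      \<comment> \<open>\<open>U\<close> has least cardinality among nonzero submodules, and
        \<open>W\<close> is one inside it.\<close>
      then have "W = U" using minimal WU card_seteq[OF fin_U WU] by blast
      then show ?thesis by simp
    qed simp
  next
    fix g assume g: "g \<in> carrier G" and fixes_all: "\<And>v. v \<in> carrier (A\<lparr>carrier := U\<rparr>) \<Longrightarrow> translate G g v = v"
    let ?K = "{g \<in> carrier G. \<forall>v\<in>carrier (A\<lparr>carrier := U\<rparr>). translate G g v = v}"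
    have "?K = {\<one>}"
    proof (rule ccontr)
      assume "?K \<noteq> {\<one>}"
      then have "H \<subseteq> ?K" by (rule monolith[OF act.normal_kernel_action])
      then have "v = \<one>\<^bsub>A\<^esub>" if "v \<in> U" for v
        using that U_sub(2) by (intro fixed_zero) auto
      then show False using U_sub(3) subgroup.one_closed[OF U_sub(1)] by blast
    qed
    then show "g = \<one>" using g fixes_all by blast
  qed
  then show thesis using d by (rule that)
qed

subsection \<open>The tower of extensions\<close>

text \<open>The induction invariant. Besides solvability and a monolith it asks that every nilpotent
  series have length at least \<open>k\<close> and that every maximal subgroup miss a prime divisor
  of the order.\<close>

definition height_group :: "nat \<Rightarrow> nat monoid \<Rightarrow> bool" where
  "height_group k G \<longleftrightarrow>
     group G \<and> finite (carrier G) \<and> solvable G \<and>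
     (\<exists>N. N \<lhd> G \<and> N \<noteq> {\<one>\<^bsub>G\<^esub>} \<and> (\<forall>M. M \<lhd> G \<longrightarrow> M \<noteq> {\<one>\<^bsub>G\<^esub>} \<longrightarrow> N \<subseteq> M)) \<and>
     (\<forall>h F. nilpotent_series G h F \<longrightarrow> k \<le> h) \<and>
     (\<forall>M. maximal_subgroup M G \<longrightarrow> (\<exists>r::nat. prime r \<and> r dvd order G \<and> \<not> r dvd card M))"

text \<open>One storey of the tower: the semidirect product with a faithful irreducible module over
  the field with \<open>p\<close> elements. The bound on \<open>order G\<close> is kept for the
  final estimate of \<open>d\<close>.\<close>

lemma height_group_extension:
  fixes p :: nat
  assumes G: "height_group k G" and p: "prime p" "\<not> p dvd order G"
  obtains E \<pi> V d where "height_group (Suc k) E"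
    "monolithic_extension E G \<pi> V p d" "order G \<le> (p ^ d) ^ (p ^ d)"
proof -
  interpret G: group G using G by (simp add: height_group_def)
  have fin: "finite (carrier G)" and solv: "solvable G" using G by (simp_all add: height_group_def)
  obtain N where N: "N \<lhd> G" "N \<noteq> {\<one>\<^bsub>G\<^esub>}" "\<And>M. M \<lhd> G \<Longrightarrow> M \<noteq> {\<one>\<^bsub>G\<^esub>} \<Longrightarrow> N \<subseteq> M"
    using G unfolding height_group_def by blast
  interpret N: normal N G by (rule N(1))
  obtain V :: "(nat \<Rightarrow> int) monoid" and act d where V:
    "faithful_irreducible_action V G act" "order V = p ^ d"
    using N.exists_faithful_irreducible_module[OF fin N(2,3) p] .
  interpret act: faithful_irreducible_action V G act by (rule V(1))
  interpret S: monolithic_extension act.E G snd "carrier V \<times> {\<one>\<^bsub>G\<^esub>}" p d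
    using fin V(2) p by (rule act.monolithic_extension_semidirect_product)
  \<comment> \<open>An injection of the finite carrier into the naturals yields an isomorphic copy
    of the required type.\<close>
  obtain f :: "(nat \<Rightarrow> int) \<times> nat \<Rightarrow> nat" where f: "inj_on f (carrier act.E)"
    using finite_imp_inj_to_nat_seg[OF S.finite_E] by blast
  define E where "E = image_group f act.E"
  have "group E" unfolding E_def by (rule S.G.inj_imp_image_group_is_group[OF f])
  have "inv_into (carrier act.E) f \<in> iso E act.E"
    unfolding E_def by (rule S.G.iso_set_sym[OF inj_imp_image_group_iso[OF f]])
  then obtain \<pi> W where ext: "monolithic_extension E G \<pi> W p d"
    using S.iso_transport[OF \<open>group E\<close>] by blast
  interpret E: monolithic_extension E G \<pi> W p d by (rule ext)
  have "height_group (Suc k) E"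
    unfolding height_group_def
  proof (intro conjI allI impI exI[of _ W])
    show "group E" by fact
    show "finite (carrier E)" by (rule E.finite_E)
    show "solvable E" by (rule E.solvable_E[OF solv])
    show "W \<lhd> E" by (rule E.normal_V)
    show "W \<noteq> {\<one>\<^bsub>E\<^esub>}" by (rule E.nontrivial)
    show "W \<subseteq> M" if "M \<lhd> E" "M \<noteq> {\<one>\<^bsub>E\<^esub>}" for M using that by (rule E.monolith)
    show "Suc k \<le> h" if series: "nilpotent_series E h F" for h F
    proof -
      obtain h' F' where "h = Suc h'" "nilpotent_series G h' F'"
        using E.nilpotent_series_quotient[OF series] by blast
      then show ?thesis using G unfolding height_group_def by blast
    qed
    show "\<exists>r::nat. prime r \<and> r dvd order E \<and> \<not> r dvd card M" if "maximal_subgroup M E" for M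
      using that G unfolding height_group_def by (intro E.maximal_subgroup_misses_prime) blast+
  qed
  then show thesis
    using ext act.order_le unfolding V(2) by (rule that)
qed

text \<open>The base of the tower: a group of prime order is its own monolith, and its only maximal
  subgroup is trivial, missing \<open>q\<close>. With index 0 the condition on series lengths is
  vacuous.\<close>

lemma height_group_prime_order:
  fixes q :: nat
  assumes "prime q"
  obtains G where "height_group 0 G" "order G = q"
proof -
  let ?Z = "integer_mod_group q"
  have q: "q > 1" using assms prime_gt_1_nat by blast
  have carrier_Z: "carrier ?Z = {0..<int q}" using q by (simp add: carrier_integer_mod_group)
  define G where "G = image_group nat ?Z"
  have inj: "inj_on nat (carrier ?Z)" by (auto simp: carrier_Z inj_on_def)
  interpret Z: comm_group ?Z by simp
  have "nat \<in> iso ?Z G"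
    unfolding G_def by (rule inj_imp_image_group_iso[OF inj])
  then interpret G: comm_group G
    using Z.iso_imp_comm_group[of G] group.is_monoid[OF Z.inj_imp_image_group_is_group[OF inj]]
    unfolding is_iso_def G_def by blast
  have order: "order G = q"
    using card_image[OF inj] by (simp add: order_def G_def image_group_def carrier_Z)
  then have fin: "finite (carrier G)" using q by (metis card.infinite not_one_less_zero order_def)
  have subgroups: "M = {\<one>\<^bsub>G\<^esub>} \<or> M = carrier G" if M: "subgroup M G" for M
  proof -
    interpret M: subgroup M G by fact
    have "card M dvd q" using G.lagrange[OF M] unfolding order[symmetric] by (metis dvd_triv_right)
    then consider "card M = 1" | "card M = card (carrier G)"
      using assms prime_nat_iff order unfolding order_def by metis
    then show ?thesis
    proof cases
      case 1 then show ?thesis using M.one_closed by (metis card_1_singletonE singletonD)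
    next
      case 2 then show ?thesis using card_subset_eq[OF fin M.subset] by blast
    qed
  qed
  have ne: "carrier G \<noteq> {\<one>\<^bsub>G\<^esub>}" using order q by (auto simp: order_def)
  have "height_group 0 G"
    unfolding height_group_def
  proof (intro conjI allI impI exI[of _ "carrier G"])
    show "solvable G"
      using G.derived_eq_singleton[of "carrier G"]
      by (auto simp: G.solvable_iff_trivial_derived_seq intro: exI[of _ 1])
    show "carrier G \<subseteq> M" if "M \<lhd> G" "M \<noteq> {\<one>\<^bsub>G\<^esub>}" for M
      using that subgroups normal_imp_subgroup by blast
    fix M assume "maximal_subgroup M G"
    then have "M = {\<one>\<^bsub>G\<^esub>}" using subgroups by (auto simp: maximal_subgroup_def)
    then show "\<exists>r::nat. prime r \<and> r dvd order G \<and> \<not> r dvd card M"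
      using assms q by (intro exI[of _ q]) (simp add: order)
  qed (use fin ne G.normal_self G.is_group in simp_all)
  then show thesis using order by (rule that)
qed

text \<open>Only odd primes are spent here, so that 2 stays available for the last extension. Orders
  only grow, which preserves the bound \<open>q\<close>.\<close>

lemma height_group_exists:
  fixes q :: nat
  assumes "prime q" "odd q"
  shows "\<exists>G. height_group k G \<and> odd (order G) \<and> q \<le> order G"
proof (induction k)
  case 0
  then show ?case using height_group_prime_order[OF assms(1)] assms(2) by (metis order_refl)
next
  case (Suc k)
  then obtain G where G: "height_group k G" "odd (order G)" "q \<le> order G" by blast
  \<comment> \<open>A prime above the order is automatically coprime to it, and it is odd because
    the order is at least 2.\<close>
  obtain p :: nat where p: "prime p" "p > order G" using bigger_prime by blast
  have pos: "order G > 0" using prime_gt_0_nat[OF assms(1)] G(3) by linarith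
  have "\<not> p dvd order G" using p(2) pos by (simp add: nat_dvd_not_less)
  then obtain E \<pi> V d where E: "height_group (Suc k) E" "monolithic_extension E G \<pi> V p d"
    by (rule height_group_extension[OF G(1) p(1)])
  interpret E: monolithic_extension E G \<pi> V p d by fact
  have "p > 2" using p(2) G(3) prime_ge_2_nat[OF assms(1)] by linarith
  then have "odd p" using p(1) prime_odd_nat by blast
  then have "odd (order E)" using G(2) by (simp add: E.order_eq)
  moreover have "1 \<le> p ^ d" using p(1) prime_gt_0_nat by (simp add: Suc_le_eq)
  then have "q \<le> order E" using G(3) mult_le_mono[of 1 "p ^ d" q "order G"] by (simp add: E.order_eq)
  ultimately show ?case using E(1) by blast
qed

section \<open>The rank bound and the final choice of primes\<close>

lemma (in group) group_rank_ge:
  assumes "finite (carrier G)" "prime p" "chief_factor G H K" "order (subquotient G H K) = p ^ k"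
  shows "k \<le> group_rank G"
  unfolding group_rank_def
proof (rule Greatest_le_nat[where b = "order G"])
  show "\<exists>H K p. prime (p::nat) \<and> chief_factor G H K \<and> order (subquotient G H K) = p ^ k"
    using assms by blast
  fix l assume "\<exists>H K p. prime (p::nat) \<and> chief_factor G H K \<and> order (subquotient G H K) = p ^ l"
  then obtain H K p where p: "prime (p::nat)" and H: "H \<lhd> G"
    and eq: "order (subquotient G H K) = p ^ l"
    unfolding chief_factor_def by blast
  interpret H: normal H G by fact
  have fin: "finite H" using assms(1) H.subset finite_subset by blast
  \<comment> \<open>The candidates for \<open>GREATEST\<close> must be bounded: the exponent lies
    below the order of the chief factor, which is at most \<open>order G\<close>.\<close>
  have "l < 2 ^ l" by simp
  also have "\<dots> \<le> p ^ l" using prime_ge_2_nat[OF p] by (rule power_mono) simp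
  also have "\<dots> = card ((\<lambda>x. K #> x) ` H)" by (simp add: eq[symmetric] order_def carrier_FactGroup)
  also have "\<dots> \<le> card H" using fin by (rule card_image_le)
  also have "\<dots> \<le> order G" unfolding order_def using assms(1) H.subset by (rule card_mono)
  finally show "l \<le> order G" by simp
qed

theorem theoremB:
  fixes n :: nat
  assumes "n \<ge> 1"
  shows "\<exists>G :: nat monoid.
           group G \<and> finite (carrier G) \<and> solvable G \<and>
           nilpotency_length G \<ge> n \<and> group_rank G \<ge> n \<and>
           (\<forall>M. maximal_subgroup M G \<longrightarrow>
                prime_divisors_order (G\<lparr>carrier := M\<rparr>) = prime_divisors_order G \<longrightarrow>
                supersolvable_group (G\<lparr>carrier := M\<rparr>))"
proof -
  \<comment> \<open>The threshold is the bound on \<open>order G\<close> that a module of order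
    \<open>2 ^ n\<close> would give; exceeding it will force \<open>n \<le> d\<close>.\<close>
  obtain q :: nat where q: "prime q" "q > (2 ^ n) ^ (2 ^ n)" using bigger_prime by blast
  have "(2::nat) \<le> (2 ^ n) ^ (2 ^ n)" using assms by (simp flip: power_mult add: self_le_power)
  then have "odd q" using q prime_odd_nat by auto
  then obtain G where G: "height_group n G" "odd (order G)" "q \<le> order G"
    using height_group_exists[OF q(1)] by blast
  \<comment> \<open>The last extension uses the prime 2, which is coprime to the odd order of
    \<open>G\<close>.\<close>
  obtain E \<pi> V d where E: "height_group (Suc n) E" "monolithic_extension E G \<pi> V 2 d"
    and bound: "order G \<le> (2 ^ d) ^ (2 ^ d)"
    using height_group_extension[OF G(1) two_is_prime_nat G(2)] by blast
  interpret E: monolithic_extension E G \<pi> V 2 d by fact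
  have "n \<le> d"
  proof (rule ccontr)
    assume "\<not> n \<le> d"
    then have "(2::nat) ^ d \<le> 2 ^ n" by simp
    then have "((2::nat) ^ d) ^ (2 ^ d) \<le> (2 ^ n) ^ (2 ^ d)" by (rule power_mono) simp
    also have "\<dots> \<le> (2 ^ n) ^ (2 ^ n)"
      using \<open>(2::nat) ^ d \<le> 2 ^ n\<close> by (rule power_increasing) simp
    finally show False using bound G(3) q(2) by linarith
  qed
  have solv: "solvable E" using E(1) by (simp add: height_group_def)
  have "d \<le> group_rank E"
  proof (rule E.G.group_rank_ge[OF E.finite_E E.prime_p E.chief_factor_V])
    interpret EV: group "E\<lparr>carrier := V\<rparr>" by (rule E.G.subgroup_imp_group[OF E.V.subgroup_axioms])
    have "finite V" using E.finite_E E.V.subset finite_subset by blast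
    then show "order (subquotient E V {\<one>\<^bsub>E\<^esub>}) = 2 ^ d"
      using EV.card_rcosets_triv by (simp add: order_def FactGroup_def E.card_V)
  qed
  moreover have "n \<le> nilpotency_length E"
  proof -
    obtain h F where "nilpotent_series E h F" using E.G.solvable_imp_nilpotent_series[OF solv] .
    then have "\<exists>h F. nilpotent_series E h F" by blast
    \<comment> \<open>Solvability supplies some series, so the least length is that of an actual
      series and the invariant applies to it.\<close>
    then have "\<exists>F. nilpotent_series E (nilpotency_length E) F"
      unfolding nilpotency_length_def by (rule LeastI_ex)
    then have "Suc n \<le> nilpotency_length E" using E(1) unfolding height_group_def by blast
    then show ?thesis by simp
  qed
  \<comment> \<open>Every maximal subgroup loses a prime, so the requirement of supersolvability
    holds vacuously.\<close>
  moreover have "prime_divisors_order (E\<lparr>carrier := M\<rparr>) \<noteq> prime_divisors_order E"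
    if M: "maximal_subgroup M E" for M
  proof -
    obtain r :: nat where "prime r" "r dvd order E" "\<not> r dvd card M"
      using E(1) M unfolding height_group_def by blast
    then show ?thesis by (auto simp: prime_divisors_order_def order_def)
  qed
  ultimately show ?thesis
    using \<open>n \<le> d\<close> E.G.is_group E.finite_E solv
    by (intro exI[of _ E]) auto
qed

end
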